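(* Let $M,M'$ be transmetric spaces. The map $d:J(M,M')^2\to\mathbb R_+$ given by $d((\varphi,a,a'),(\psi,b,b'))=d(\gamma(a',b').\varphi,\ \psi.\gamma(a,b))$ (distance between jets $(M,a)\to(M',b')$) factors through the quotient by $\sim$ and gives a distance (i.e. a metric) on the set $\mathbb{J}\mathrm{et}_{\mathrm{free}}(M,M')=J(M,M')/\!\sim$, defined by $d([\varphi,a,a'],[\psi,b,b'])=d((\varphi,a,a'),(\psi,b,b'))$ for all $(\varphi,a,a'),(\psi,b,b')\in J(M,M')$.
   Context: Jets. For metric spaces $M,M'$ and $a\in M$, maps $f,g:M\to M'$ are tangent at $a$ if $\forall\varepsilon>0\ \exists\eta>0\ \forall x\ (d(x,a)\le\eta\Rightarrow d(f(x),g(x))\le\varepsilon\, d(x,a))$. A map is $k$-$LL_a$ if it is $k$-Lipschitz on some neighborhood of $a$, and $LL_a$ if it is $k$-$LL_a$ for some $k>0$. $\mathbb{J}\mathrm{et}((M,a),(M',a'))$ is the set of equivalence classes (called jets $(M,a)\to(M',a')$) of maps $f:M\to M'$ that are $LL_a$ with $f(a)=a'$, under tangency at $a$. Composition of representatives induces a composition of jets; pointed metric spaces and jets form a category $\mathbb{J}\mathrm{et}$. The distance between two jets represented by $f,g$ is $d(f,g)=\lim_{r\to0}\sup\{C(x)\mid d(x,a)\le r\}$ with $C(a)=0$, $C(x)=d(f(x),g(x))/d(x,a)$ for $x\neq a$; this is a well-defined metric on $\mathbb{J}\mathrm{et}((M,a),(M',a'))$. The Lipschitz ratio of a jet $\varphi$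 is $\rho(\varphi)=\inf\{k>0\mid\exists f\in\varphi,\ f\text{ is }k\text{-}LL_a\}$. Transmetric spaces. A transmetric space is a non-empty metric space $M$ equipped with jets $\gamma(a,b):(M,a)\to(M,b)$ for all $a,b\in M$ such that $\gamma(a,a)$ is the identity jet, $\gamma(b,c).\gamma(a,b)=\gamma(a,c)$ and $\rho(\gamma(a,b))\le1$ for all $a,b,c\in M$. For transmetric spaces $M,M'$ (both families denoted $\gamma$), $J(M,M')=\coprod_{(a,a')\in M\times M'}\mathbb{J}\mathrm{et}((M,a),(M',a'))$, with elements written $(\varphi,a,a')$. The equivalence relation $\sim$ on $J(M,M')$ is: $(\varphi,a,a')\sim(\psi,b,b')$ iff $\gamma(a',b').\varphi=\psi.\gamma(a,b)$. The class of $(\varphi,a,a')$ is written $[\varphi,a,a']$. *)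

theory Defs
  imports "HOL-Analysis.Analysis"
begin

type_synonym ('a, 'b) jet = "('a \<Rightarrow> 'b) set"

definition tangent_at :: "'a::metric_space \<Rightarrow> ('a \<Rightarrow> 'b::metric_space) \<Rightarrow> ('a \<Rightarrow> 'b) \<Rightarrow> bool" where
  "tangent_at a f g \<longleftrightarrow>
     (\<forall>\<epsilon>>0. \<exists>\<eta>>0. \<forall>x. dist x a \<le> \<eta> \<longrightarrow> dist (f x) (g x) \<le> \<epsilon> * dist x a)"

definition lip_near :: "real \<Rightarrow> 'a::metric_space \<Rightarrow> ('a \<Rightarrow> 'b::metric_space) \<Rightarrow> bool" where
  "lip_near k a f \<longleftrightarrow> (\<exists>U. a \<in> interior U \<and> k-lipschitz_on U f)"

definition LL_at :: "'a::metric_space \<Rightarrow> ('a \<Rightarrow> 'b::metric_space) \<Rightarrow> bool" where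
  "LL_at a f \<longleftrightarrow> (\<exists>k>0. lip_near k a f)"

definition LL_maps :: "'a::metric_space \<Rightarrow> 'b::metric_space \<Rightarrow> ('a \<Rightarrow> 'b) set" where
  "LL_maps a a' = {f. LL_at a f \<and> f a = a'}"

definition tangency :: "'a::metric_space \<Rightarrow> 'b::metric_space \<Rightarrow> (('a \<Rightarrow> 'b) \<times> ('a \<Rightarrow> 'b)) set" where
  "tangency a a' = {(f, g). f \<in> LL_maps a a' \<and> g \<in> LL_maps a a' \<and> tangent_at a f g}"

definition Jet :: "'a::metric_space \<Rightarrow> 'b::metric_space \<Rightarrow> ('a, 'b) jet set" where
  "Jet a a' = LL_maps a a' // tangency a a'"

definition jet_of :: "'a::metric_space \<Rightarrow> ('a \<Rightarrow> 'b::metric_space) \<Rightarrow> ('a, 'b) jet" where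
  "jet_of a f = tangency a (f a) `` {f}"

text \<open>
  A jet, being a bare set of maps, does not determine its source point (for instance when that
  point is isolated), so the operations below take the source point as an explicit argument.
  The set given to \<^const>\<open>the_elem\<close> is a singleton whenever the arguments are (composable or
  parallel) jets; see \<open>jet_comp_jet_of\<close> and \<open>jet_dist_jet_of\<close>.
\<close>

definition jet_comp :: "'a::metric_space \<Rightarrow> ('b::metric_space, 'c::metric_space) jet \<Rightarrow> ('a, 'b) jet \<Rightarrow> ('a, 'c) jet" where
  "jet_comp a \<psi> \<phi> = the_elem {jet_of a (g \<circ> f) | g f. g \<in> \<psi> \<and> f \<in> \<phi>}"

definition diff_quot :: "'a::metric_space \<Rightarrow> ('a \<Rightarrow> 'b::metric_space) \<Rightarrow> ('a \<Rightarrow> 'b) \<Rightarrow> 'a \<Rightarrow> real" where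
  "diff_quot a f g x = (if x = a then 0 else dist (f x) (g x) / dist x a)"

text \<open>
  The real supremum below is only meaningful when the quotients are bounded on the ball, which
  holds for all sufficiently small radii when the two maps are locally Lipschitz at \<open>a\<close> and agree
  there; only such radii matter for the limit.
\<close>

definition map_dist :: "'a::metric_space \<Rightarrow> ('a \<Rightarrow> 'b::metric_space) \<Rightarrow> ('a \<Rightarrow> 'b) \<Rightarrow> real" where
  "map_dist a f g = Lim (at_right 0) (\<lambda>r. Sup {diff_quot a f g x | x. dist x a \<le> r})"

definition jet_dist :: "'a::metric_space \<Rightarrow> ('a, 'b::metric_space) jet \<Rightarrow> ('a, 'b) jet \<Rightarrow> real" where
  "jet_dist a \<phi> \<psi> = the_elem {map_dist a f g | f g. f \<in> \<phi> \<and> g \<in> \<psi>}"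

definition lip_ratio :: "'a::metric_space \<Rightarrow> ('a, 'b::metric_space) jet \<Rightarrow> real" where
  "lip_ratio a \<phi> = Inf {k. k > 0 \<and> (\<exists>f\<in>\<phi>. lip_near k a f)}"

locale transmetric_space =
  fixes \<gamma> :: "'a::metric_space \<Rightarrow> 'a \<Rightarrow> ('a, 'a) jet"
  assumes trans_jet: "\<And>a b. \<gamma> a b \<in> Jet a b"
    and trans_id: "\<And>a. \<gamma> a a = jet_of a id"
    and trans_comp: "\<And>a b c. jet_comp a (\<gamma> b c) (\<gamma> a b) = \<gamma> a c"
    and trans_ratio: "\<And>a b. lip_ratio a (\<gamma> a b) \<le> 1"

definition J :: "(('a::metric_space, 'b::metric_space) jet \<times> 'a \<times> 'b) set" where
  "J = {(\<phi>, a, a'). \<phi> \<in> Jet a a'}"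

definition J_equiv ::
  "('a::metric_space \<Rightarrow> 'a \<Rightarrow> ('a, 'a) jet) \<Rightarrow> ('b::metric_space \<Rightarrow> 'b \<Rightarrow> ('b, 'b) jet) \<Rightarrow>
   ((('a, 'b) jet \<times> 'a \<times> 'b) \<times> (('a, 'b) jet \<times> 'a \<times> 'b)) set" where
  "J_equiv \<gamma> \<gamma>' = {((\<phi>, a, a'), (\<psi>, b, b')).
     (\<phi>, a, a') \<in> J \<and> (\<psi>, b, b') \<in> J \<and>
     jet_comp a (\<gamma>' a' b') \<phi> = jet_comp a \<psi> (\<gamma> a b)}"

fun J_dist ::
  "('a::metric_space \<Rightarrow> 'a \<Rightarrow> ('a, 'a) jet) \<Rightarrow> ('b::metric_space \<Rightarrow> 'b \<Rightarrow> ('b, 'b) jet) \<Rightarrow>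
   ('a, 'b) jet \<times> 'a \<times> 'b \<Rightarrow> ('a, 'b) jet \<times> 'a \<times> 'b \<Rightarrow> real" where
  "J_dist \<gamma> \<gamma>' (\<phi>, a, a') (\<psi>, b, b') =
     jet_dist a (jet_comp a (\<gamma>' a' b') \<phi>) (jet_comp a \<psi> (\<gamma> a b))"

definition Jet_free ::
  "('a::metric_space \<Rightarrow> 'a \<Rightarrow> ('a, 'a) jet) \<Rightarrow> ('b::metric_space \<Rightarrow> 'b \<Rightarrow> ('b, 'b) jet) \<Rightarrow>
   (('a, 'b) jet \<times> 'a \<times> 'b) set set" where
  "Jet_free \<gamma> \<gamma>' = J // J_equiv \<gamma> \<gamma>'"

lemma tangent_at_refl: "tangent_at a f f"
proof -
  have "\<exists>\<eta>>0::real. \<forall>x. dist x a \<le> \<eta> \<longrightarrow> dist (f x) (f x) \<le> \<epsilon> * dist x a" if "\<epsilon> > 0" for \<epsilon>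
    using that by (intro exI[of _ 1]) auto
  then show ?thesis by (simp add: tangent_at_def)
qed

lemma tangent_at_sym: "tangent_at a f g \<Longrightarrow> tangent_at a g f"
  by (simp add: tangent_at_def dist_commute)

lemma tangent_at_trans:
  assumes "tangent_at a f g" "tangent_at a g h"
  shows "tangent_at a f h"
  unfolding tangent_at_def
proof (intro allI impI)
  fix \<epsilon> :: real assume "\<epsilon> > 0"
  then have e: "\<epsilon> / 2 > 0" by simp
  obtain \<eta>1 where 1: "\<eta>1 > 0" "\<And>x. dist x a \<le> \<eta>1 \<Longrightarrow> dist (f x) (g x) \<le> \<epsilon> / 2 * dist x a"
    using assms(1) e unfolding tangent_at_def by blast
  obtain \<eta>2 where 2: "\<eta>2 > 0" "\<And>x. dist x a \<le> \<eta>2 \<Longrightarrow> dist (g x) (h x) \<le> \<epsilon> / 2 * dist x a"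
    using assms(2) e unfolding tangent_at_def by blast
  show "\<exists>\<eta>>0. \<forall>x. dist x a \<le> \<eta> \<longrightarrow> dist (f x) (h x) \<le> \<epsilon> * dist x a"
  proof (intro exI[of _ "min \<eta>1 \<eta>2"] conjI allI impI)
    fix x assume "dist x a \<le> min \<eta>1 \<eta>2"
    then have "dist (f x) (g x) + dist (g x) (h x) \<le> \<epsilon> / 2 * dist x a + \<epsilon> / 2 * dist x a"
      by (intro add_mono 1 2) auto
    then show "dist (f x) (h x) \<le> \<epsilon> * dist x a"
      using dist_triangle[of "f x" "h x" "g x"] by (simp add: field_simps)
  qed (use 1 2 in auto)
qed

lemma equiv_tangency: "equiv (LL_maps a a') (tangency a a')"
  by (rule equivI)
    (auto simp: refl_on_def tangency_def tangent_at_refl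
      intro!: symI transI intro: tangent_at_sym tangent_at_trans)

lemma jet_of_eq_iff:
  assumes "f \<in> LL_maps a a'" "g \<in> LL_maps a a'"
  shows "jet_of a f = jet_of a g \<longleftrightarrow> tangent_at a f g"
proof -
  have "f a = a'" "g a = a'" using assms by (auto simp: LL_maps_def)
  then show ?thesis
    using eq_equiv_class_iff[OF equiv_tangency assms] assms by (simp add: jet_of_def tangency_def)
qed

lemma mem_jet_of:
  assumes "f \<in> LL_maps a a'"
  shows "g \<in> jet_of a f \<longleftrightarrow> g \<in> LL_maps a a' \<and> tangent_at a f g"
  using assms by (auto simp: jet_of_def tangency_def LL_maps_def)

lemma Jet_eq: "Jet a a' = jet_of a ` LL_maps a a'"
proof -
  have "jet_of a f = tangency a a' `` {f}" if "f \<in> LL_maps a a'" for f :: "'a \<Rightarrow> 'b"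
    using that by (simp add: jet_of_def LL_maps_def)
  then show ?thesis by (auto simp: Jet_def quotient_def)
qed

lemma LL_mapsE:
  assumes "f \<in> LL_maps a a'"
  obtains k r where "k > 0" "r > 0" "k-lipschitz_on (cball a r) f" "f a = a'"
proof -
  obtain k U where k: "k > 0" "a \<in> interior U" "k-lipschitz_on U f" "f a = a'"
    using assms by (auto simp: LL_maps_def LL_at_def lip_near_def)
  then obtain r where "r > 0" "cball a r \<subseteq> U"
    by (auto simp: mem_interior_cball)
  with k that show thesis by (meson lipschitz_on_subset)
qed

lemma LL_mapsI:
  assumes "k > 0" "r > 0" "k-lipschitz_on (cball a r) f" "f a = a'"
  shows "f \<in> LL_maps a a'"
  using assms mem_interior_cball[of a "cball a r"]
  by (auto simp: LL_maps_def LL_at_def lip_near_def)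

lemma lipschitz_on_cball_comp:
  assumes "k-lipschitz_on (cball a r) f" "l-lipschitz_on (cball (f a) s) g"
    and "k > 0" "t \<le> r" "k * t \<le> s"
  shows "(l * k)-lipschitz_on (cball a t) (g \<circ> f)"
proof (rule lipschitz_on_compose)
  show "k-lipschitz_on (cball a t) f"
    by (rule lipschitz_on_subset[OF assms(1)]) (use assms in auto)
  have "f ` cball a t \<subseteq> cball (f a) s"
  proof clarsimp
    fix x assume x: "dist a x \<le> t"
    then have "0 \<le> r" using assms(4) zero_le_dist[of a x] by linarith
    then have "dist (f a) (f x) \<le> k * dist a x"
      using x assms by (intro lipschitz_onD[OF assms(1)]) auto
    also have "\<dots> \<le> k * t" using x assms by simp
    finally show "dist (f a) (f x) \<le> s" using assms by simp
  qed
  then show "l-lipschitz_on (f ` cball a t) g"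
    by (rule lipschitz_on_subset[OF assms(2)])
qed

lemma LL_maps_comp:
  assumes "f \<in> LL_maps a a'" "g \<in> LL_maps a' a''"
  shows "g \<circ> f \<in> LL_maps a a''"
proof -
  obtain k r where f: "k > 0" "r > 0" "k-lipschitz_on (cball a r) f" "f a = a'"
    using assms(1) by (rule LL_mapsE)
  obtain l s where g: "l > 0" "s > 0" "l-lipschitz_on (cball a' s) g" "g a' = a''"
    using assms(2) by (rule LL_mapsE)
  have "(l * k)-lipschitz_on (cball a (min r (s / k))) (g \<circ> f)"
    using f g by (intro lipschitz_on_cball_comp[of k a r f l s]) (auto simp: min_def field_simps)
  then show ?thesis
    using f g by (intro LL_mapsI[of "l * k" "min r (s / k)"]) auto
qed

lemma tangent_at_comp:
  assumes f: "f1 \<in> LL_maps a a'" "f2 \<in> LL_maps a a'" "tangent_at a f1 f2"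
    and g: "g1 \<in> LL_maps a' a''" "g2 \<in> LL_maps a' a''" "tangent_at a' g1 g2"
  shows "tangent_at a (g1 \<circ> f1) (g2 \<circ> f2)"
  unfolding tangent_at_def
proof (intro allI impI)
  fix \<epsilon> :: real assume e: "\<epsilon> > 0"
  obtain k r where k: "k > 0" "r > 0" "k-lipschitz_on (cball a r) f1" "f1 a = a'"
    using f(1) by (rule LL_mapsE)
  obtain k' r' where k': "k' > 0" "r' > 0" "k'-lipschitz_on (cball a r') f2" "f2 a = a'"
    using f(2) by (rule LL_mapsE)
  obtain l s where l: "l > 0" "s > 0" "l-lipschitz_on (cball a' s) g2" "g2 a' = a''"
    using g(2) by (rule LL_mapsE)
  have "\<epsilon> / (2 * k) > 0" "\<epsilon> / (2 * l) > 0" using e k l by auto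
  obtain \<eta>1 where 1: "\<eta>1 > 0"
      "\<And>x. dist x a \<le> \<eta>1 \<Longrightarrow> dist (f1 x) (f2 x) \<le> \<epsilon> / (2 * l) * dist x a"
    using f(3) \<open>\<epsilon> / (2 * l) > 0\<close> unfolding tangent_at_def by blast
  obtain \<eta>2 where 2: "\<eta>2 > 0"
      "\<And>y. dist y a' \<le> \<eta>2 \<Longrightarrow> dist (g1 y) (g2 y) \<le> \<epsilon> / (2 * k) * dist y a'"
    using g(3) \<open>\<epsilon> / (2 * k) > 0\<close> unfolding tangent_at_def by blast
  define \<eta> where "\<eta> = Min {r, r', \<eta>1, \<eta>2 / k, s / k, s / k'}"
  have pos: "\<eta> > 0" using k k' l 1 2 by (auto simp: \<eta>_def)
  have le: "\<eta> \<le> r" "\<eta> \<le> r'" "\<eta> \<le> \<eta>1" "\<eta> \<le> \<eta>2 / k" "\<eta> \<le> s / k" "\<eta> \<le> s / k'"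
    by (auto simp: \<eta>_def)
  then have le': "k * \<eta> \<le> \<eta>2" "k * \<eta> \<le> s" "k' * \<eta> \<le> s"
    using k k' by (auto simp: field_simps)
  show "\<exists>\<eta>>0. \<forall>x. dist x a \<le> \<eta> \<longrightarrow> dist ((g1 \<circ> f1) x) ((g2 \<circ> f2) x) \<le> \<epsilon> * dist x a"
  proof (intro exI[of _ \<eta>] conjI allI impI pos)
    fix x assume x: "dist x a \<le> \<eta>"
    have d1: "dist (f1 x) a' \<le> k * dist x a"
      using lipschitz_onD[OF k(3), of x a] x k le by (simp add: dist_commute)
    have d2: "dist (f2 x) a' \<le> k' * dist x a"
      using lipschitz_onD[OF k'(3), of x a] x k' le by (simp add: dist_commute)
    have m: "k * dist x a \<le> k * \<eta>" "k' * dist x a \<le> k' * \<eta>" using x k k' by auto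
    have "dist (g1 (f1 x)) (g2 (f1 x)) \<le> \<epsilon> / (2 * k) * dist (f1 x) a'"
      using d1 m le' by (intro 2) linarith
    also have "\<dots> \<le> \<epsilon> / (2 * k) * (k * dist x a)"
      using d1 e k by (intro mult_left_mono) auto
    finally have A: "dist (g1 (f1 x)) (g2 (f1 x)) \<le> \<epsilon> / 2 * dist x a" using k by simp
    have "dist (g2 (f1 x)) (g2 (f2 x)) \<le> l * dist (f1 x) (f2 x)"
      using d1 d2 m le' by (intro lipschitz_onD[OF l(3)]) (auto simp: dist_commute)
    also have "\<dots> \<le> l * (\<epsilon> / (2 * l) * dist x a)"
      using x le l by (intro mult_left_mono 1) auto
    finally have B: "dist (g2 (f1 x)) (g2 (f2 x)) \<le> \<epsilon> / 2 * dist x a" using l by simp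
    show "dist ((g1 \<circ> f1) x) ((g2 \<circ> f2) x) \<le> \<epsilon> * dist x a"
      using A B dist_triangle[of "g1 (f1 x)" "g2 (f2 x)" "g2 (f1 x)"] by (simp add: field_simps)
  qed
qed

lemma jet_comp_jet_of:
  assumes "f \<in> LL_maps a a'" "g \<in> LL_maps a' a''"
  shows "jet_comp a (jet_of a' g) (jet_of a f) = jet_of a (g \<circ> f)"
proof -
  have "jet_of a (g' \<circ> f') = jet_of a (g \<circ> f)" if "g' \<in> jet_of a' g" "f' \<in> jet_of a f" for g' f'
  proof -
    have f': "f' \<in> LL_maps a a'" "tangent_at a f f'" and g': "g' \<in> LL_maps a' a''" "tangent_at a' g g'"
      using that assms by (auto simp: mem_jet_of)
    have "jet_of a (g \<circ> f) = jet_of a (g' \<circ> f')"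
      using assms f' g' by (simp add: jet_of_eq_iff[of _ a a''] LL_maps_comp tangent_at_comp)
    then show ?thesis by simp
  qed
  moreover have "g \<in> jet_of a' g" "f \<in> jet_of a f"
    using assms by (auto simp: mem_jet_of tangent_at_refl)
  ultimately have "{jet_of a (g' \<circ> f') | g' f'. g' \<in> jet_of a' g \<and> f' \<in> jet_of a f} = {jet_of a (g \<circ> f)}"
    by blast
  then show ?thesis by (simp add: jet_comp_def)
qed

lemma diff_quot_bounded:
  assumes "f \<in> LL_maps a a'" "g \<in> LL_maps a a'"
  obtains K R where "R > 0" "\<And>x. dist x a \<le> R \<Longrightarrow> diff_quot a f g x \<le> K"
proof -
  obtain k r where k: "k > 0" "r > 0" "k-lipschitz_on (cball a r) f" "f a = a'"
    using assms(1) by (rule LL_mapsE)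
  obtain l s where l: "l > 0" "s > 0" "l-lipschitz_on (cball a s) g" "g a = a'"
    using assms(2) by (rule LL_mapsE)
  have "diff_quot a f g x \<le> k + l" if x: "dist x a \<le> min r s" for x
  proof (cases "x = a")
    case False
    have "dist (f x) a' \<le> k * dist x a" "dist (g x) a' \<le> l * dist x a"
      using lipschitz_onD[OF k(3), of x a] lipschitz_onD[OF l(3), of x a] x k l
      by (auto simp: dist_commute)
    then have "dist (f x) (g x) \<le> (k + l) * dist x a"
      using dist_triangle2[of "f x" "g x" a'] by (simp add: algebra_simps)
    then show ?thesis using False by (simp add: diff_quot_def field_simps)
  qed (use k l in \<open>simp add: diff_quot_def\<close>)
  then show thesis using k l that[of "min r s" "k + l"] by auto
qed

lemma diff_quot_nonneg: "0 \<le> diff_quot a f g x"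
  by (simp add: diff_quot_def)

lemma map_dist_tendsto:
  assumes "f \<in> LL_maps a a'" "g \<in> LL_maps a a'"
  shows "((\<lambda>r. Sup {diff_quot a f g x | x. dist x a \<le> r}) \<longlongrightarrow> map_dist a f g) (at_right 0)"
proof -
  obtain K R where R: "R > 0" "\<And>x. dist x a \<le> R \<Longrightarrow> diff_quot a f g x \<le> K"
    using assms by (rule diff_quot_bounded) blast
  define S where "S r = Sup {diff_quot a f g x | x. dist x a \<le> r}" for r
  have bdd: "bdd_above {diff_quot a f g x | x. dist x a \<le> r}" if "r \<le> R" for r
    using R(2) that by (intro bdd_aboveI[of _ K]) (auto intro: order_trans)
  have nonneg: "0 \<le> S r" if "0 < r" "r \<le> R" for r
    unfolding S_def
    by (rule cSup_upper2[OF _ _ bdd[OF that(2)], of 0])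
      (use that in \<open>auto intro!: exI[of _ a] simp: diff_quot_def\<close>)
  have mono: "S r \<le> S t" if "0 < r" "r \<le> t" "t \<le> R" for r t
    unfolding S_def using that
    by (intro cSup_subset_mono bdd) (auto intro: exI[of _ a] order_trans)
  have "(S \<longlongrightarrow> Inf (S ` ({0<..} \<inter> {..<R}))) (at 0 within ({0<..} \<inter> {..<R}))"
  proof (rule tendstoI)
    fix e :: real assume "e > 0"
    let ?A = "{0<..} \<inter> {..<R}"
    have bb: "bdd_below (S ` ?A)" using nonneg by (intro bdd_belowI[of _ 0]) auto
    have ne: "?A \<noteq> {}" using R(1) dense[of 0 R] by auto
    obtain t where t: "t \<in> ?A" "S t < Inf (S ` ?A) + e"
      using cInf_lessD[of "S ` ?A" "Inf (S ` ?A) + e"] ne \<open>e > 0\<close> by auto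
    have "dist (S r) (Inf (S ` ?A)) < e" if "r \<in> ?A" "r < t" for r
      using mono[of r t] that t cInf_lower[OF imageI[OF that(1)] bb] by (auto simp: dist_real_def)
    then show "eventually (\<lambda>r. dist (S r) (Inf (S ` ?A)) < e) (at 0 within ?A)"
      using t by (auto simp: eventually_at dist_real_def intro!: exI[of _ t])
  qed
  then have "(S \<longlongrightarrow> Inf (S ` ({0<..} \<inter> {..<R}))) (at_right 0)"
    using at_within_nhd[of 0 "{..<R}" "{0<..} \<inter> {..<R}" "{0<..}"] R(1)
    by auto
  moreover from this have "Lim (at_right 0) S = Inf (S ` ({0<..} \<inter> {..<R}))"
    by (intro tendsto_Lim) auto
  ultimately show ?thesis by (simp add: map_dist_def S_def[abs_def])
qed

lemma map_dist_le:
  assumes f: "f \<in> LL_maps a a'" "f' \<in> LL_maps a a'" "tangent_at a f f'"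
    and g: "g \<in> LL_maps a a'" "g' \<in> LL_maps a a'" "tangent_at a g g'"
  shows "map_dist a f g \<le> map_dist a f' g'"
proof (rule field_le_epsilon)
  fix e :: real assume "e > 0"
  then have e: "e / 2 > 0" by simp
  obtain \<eta>1 where 1: "\<eta>1 > 0" "\<And>x. dist x a \<le> \<eta>1 \<Longrightarrow> dist (f x) (f' x) \<le> e / 2 * dist x a"
    using f(3) e unfolding tangent_at_def by blast
  obtain \<eta>2 where 2: "\<eta>2 > 0" "\<And>x. dist x a \<le> \<eta>2 \<Longrightarrow> dist (g x) (g' x) \<le> e / 2 * dist x a"
    using g(3) e unfolding tangent_at_def by blast
  obtain K R where R: "R > 0" "\<And>x. dist x a \<le> R \<Longrightarrow> diff_quot a f' g' x \<le> K"
    using f(2) g(2) by (rule diff_quot_bounded) blast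
  define h where "h = Min {\<eta>1, \<eta>2, R}"
  have h: "h > 0" "h \<le> \<eta>1" "h \<le> \<eta>2" "h \<le> R" using 1 2 R by (auto simp: h_def)
  have "Sup {diff_quot a f g x | x. dist x a \<le> r} \<le> Sup {diff_quot a f' g' x | x. dist x a \<le> r} + e"
    if r: "0 < r" "r < h" for r
  proof (rule cSup_least)
    show "{diff_quot a f g x | x. dist x a \<le> r} \<noteq> {}" using r by (auto intro: exI[of _ a])
    fix c assume "c \<in> {diff_quot a f g x | x. dist x a \<le> r}"
    then obtain x where x: "c = diff_quot a f g x" "dist x a \<le> r" by blast
    have "bdd_above {diff_quot a f' g' x | x. dist x a \<le> r}"
      using R(2) r h by (intro bdd_aboveI[of _ K]) auto
    then have up: "diff_quot a f' g' x \<le> Sup {diff_quot a f' g' x | x. dist x a \<le> r}"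
      using x by (intro cSup_upper) auto
    have "c \<le> diff_quot a f' g' x + e"
    proof (cases "x = a")
      case False
      have "dist (f x) (g x) \<le> dist (f x) (f' x) + dist (f' x) (g' x) + dist (g x) (g' x)"
        using dist_triangle[of "f x" "g x" "f' x"] dist_triangle2[of "f' x" "g x" "g' x"] by linarith
      also have "\<dots> \<le> dist (f' x) (g' x) + e * dist x a"
        using 1(2)[of x] 2(2)[of x] x r h by (simp add: field_simps)
      finally show ?thesis using False x by (simp add: diff_quot_def field_simps)
    qed (use x \<open>e > 0\<close> in \<open>simp add: diff_quot_def\<close>)
    with up show "c \<le> Sup {diff_quot a f' g' x | x. dist x a \<le> r} + e" by linarith
  qed
  then have "eventually (\<lambda>r. Sup {diff_quot a f g x | x. dist x a \<le> r}
      \<le> Sup {diff_quot a f' g' x | x. dist x a \<le> r} + e) (at_right 0)"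
    using h(1) by (auto simp: eventually_at_right_field)
  then show "map_dist a f g \<le> map_dist a f' g' + e"
    by (intro tendsto_le[OF _ tendsto_add[OF map_dist_tendsto[OF f(2) g(2)] tendsto_const]
          map_dist_tendsto[OF f(1) g(1)]]) auto
qed

lemma jet_dist_jet_of:
  assumes "f \<in> LL_maps a a'" "g \<in> LL_maps a a'"
  shows "jet_dist a (jet_of a f) (jet_of a g) = map_dist a f g"
proof -
  have "map_dist a f' g' = map_dist a f g" if "f' \<in> jet_of a f" "g' \<in> jet_of a g" for f' g'
  proof -
    have "f' \<in> LL_maps a a'" "tangent_at a f f'" "g' \<in> LL_maps a a'" "tangent_at a g g'"
      using that assms by (auto simp: mem_jet_of)
    then show ?thesis
      using assms by (intro antisym map_dist_le) (auto intro: tangent_at_sym)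
  qed
  moreover have "f \<in> jet_of a f" "g \<in> jet_of a g"
    using assms by (auto simp: mem_jet_of tangent_at_refl)
  ultimately have "{map_dist a f' g' | f' g'. f' \<in> jet_of a f \<and> g' \<in> jet_of a g} = {map_dist a f g}"
    by blast
  then show ?thesis by (simp add: jet_dist_def)
qed

end

theory Submission
  imports Defs
begin

text \<open>
  Composing with a jet of Lipschitz ratio at most 1, on either side, does not increase the distance
  of jets. Hence transporting jets along \<open>\<gamma>\<close> and \<open>\<gamma>'\<close> is contractive, and since every transport
  jet is invertible with an inverse of the same kind, \<open>J_dist\<close> is symmetric and satisfies the
  triangle inequality. So it is a pseudometric on \<open>J\<close>, and \<open>J_equiv\<close> is the relation of being at
  distance 0, because two jets at distance 0 are equal.
\<close>

section \<open>Distances of germs\<close>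

text \<open>For small radii the supremum of the quotients lies below
  \<open>map_dist a f g + e\<close>. Clearing the denominator turns this into a pointwise bound,
  which at \<open>a\<close> itself reads \<open>0 \<le> 0\<close>. With \<open>map_dist_leI\<close>
  as converse, all later estimates avoid limits and suprema.\<close>

lemma map_dist_eventually_le:
  assumes fg: "f \<in> LL_maps a a'" "g \<in> LL_maps a a'" and e: "e > 0"
  shows "\<forall>\<^sub>F x in nhds a. dist (f x) (g x) \<le> (map_dist a f g + e) * dist x a"
proof -
  obtain K R where R: "R > 0" "\<And>x. dist x a \<le> R \<Longrightarrow> diff_quot a f g x \<le> K"
    using fg by (rule diff_quot_bounded) blast
  have "\<forall>\<^sub>F r in at_right 0. Sup {diff_quot a f g x | x. dist x a \<le> r} < map_dist a f g + e"
    using order_tendstoD(2)[OF map_dist_tendsto[OF fg]] e by simp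
  then obtain h where h: "h > 0"
      "\<And>r. 0 < r \<Longrightarrow> r < h \<Longrightarrow> Sup {diff_quot a f g x | x. dist x a \<le> r} < map_dist a f g + e"
    by (auto simp: eventually_at_right_field)
  \<comment> \<open>\<open>R\<close> keeps the quotients bounded, so that the real supremum really
    is an upper bound; halving \<open>h\<close> makes \<open>r\<close> strictly smaller than
    it.\<close>
  define r where "r = min R (h / 2)"
  have r: "0 < r" "r < h" "r \<le> R" using R h(1) by (auto simp: r_def)
  have "dist (f x) (g x) \<le> (map_dist a f g + e) * dist x a" if x: "dist x a < r" for x
  proof (cases "x = a")
    case True
    then show ?thesis using fg by (simp add: LL_maps_def)
  next
    case False
    have "bdd_above {diff_quot a f g x | x. dist x a \<le> r}"
      using R(2) r by (intro bdd_aboveI[of _ K]) auto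
    then have "diff_quot a f g x \<le> Sup {diff_quot a f g x | x. dist x a \<le> r}"
      using x by (intro cSup_upper) (auto intro: less_imp_le)
    also have "\<dots> < map_dist a f g + e" using h r by simp
    finally show ?thesis using False by (simp add: diff_quot_def field_simps)
  qed
  then show ?thesis using r(1) by (auto simp: eventually_nhds_metric)
qed

text \<open>The pointwise bound passes to the supremum over each small ball and then to the limit.
  The assumption \<open>K \<ge> 0\<close> covers the value 0 that \<open>diff_quot\<close> takes at
  \<open>a\<close>, the only value there is when \<open>a\<close> is isolated and the ball is
  small.\<close>

lemma map_dist_leI:
  assumes fg: "f \<in> LL_maps a a'" "g \<in> LL_maps a a'" and K: "K \<ge> 0"
    and ev: "\<And>e. e > 0 \<Longrightarrow> \<forall>\<^sub>F x in nhds a. dist (f x) (g x) \<le> (K + e) * dist x a"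
  shows "map_dist a f g \<le> K"
proof (rule field_le_epsilon)
  fix e :: real assume e: "e > 0"
  obtain h where h: "h > 0" "\<And>x. dist x a < h \<Longrightarrow> dist (f x) (g x) \<le> (K + e) * dist x a"
    using ev[OF e] by (auto simp: eventually_nhds_metric)
  have "Sup {diff_quot a f g x | x. dist x a \<le> r} \<le> K + e" if r: "0 < r" "r < h" for r
  proof (rule cSup_least)
    show "{diff_quot a f g x | x. dist x a \<le> r} \<noteq> {}" using r by (auto intro: exI[of _ a])
    fix c assume "c \<in> {diff_quot a f g x | x. dist x a \<le> r}"
    then obtain x where x: "c = diff_quot a f g x" "dist x a < h" using r by auto
    then show "c \<le> K + e"
      using h(2)[of x] K e by (auto simp: diff_quot_def divide_simps)
  qed
  then have "\<forall>\<^sub>F r in at_right 0. Sup {diff_quot a f g x | x. dist x a \<le> r} \<le> K + e"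
    using h(1) by (auto simp: eventually_at_right_field)
  then show "map_dist a f g \<le> K + e"
    by (intro tendsto_upperbound[OF map_dist_tendsto[OF fg]]) auto
qed

text \<open>The quotient at the centre is 0 and belongs to every set, so the suprema over balls with
  bounded quotients are nonnegative, and so is their limit.\<close>

lemma map_dist_nonneg:
  assumes fg: "f \<in> LL_maps a a'" "g \<in> LL_maps a a'"
  shows "0 \<le> map_dist a f g"
proof -
  obtain K R where R: "R > 0" "\<And>x. dist x a \<le> R \<Longrightarrow> diff_quot a f g x \<le> K"
    using fg by (rule diff_quot_bounded) blast
  have "0 \<le> Sup {diff_quot a f g x | x. dist x a \<le> r}" if "0 < r" "r < R" for r
  proof (rule cSup_upper2[of "diff_quot a f g a"])
    show "bdd_above {diff_quot a f g x | x. dist x a \<le> r}"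
      using R(2) that by (intro bdd_aboveI[of _ K]) auto
  qed (use that in \<open>auto simp: diff_quot_nonneg\<close>)
  then have "\<forall>\<^sub>F r in at_right 0. 0 \<le> Sup {diff_quot a f g x | x. dist x a \<le> r}"
    using R(1) by (auto simp: eventually_at_right_field)
  then show ?thesis
    by (intro tendsto_lowerbound[OF map_dist_tendsto[OF fg]]) auto
qed

lemma map_dist_commute: "map_dist a f g = map_dist a g f"
proof -
  have "diff_quot a f g = diff_quot a g f"
    by (simp add: diff_quot_def dist_commute fun_eq_iff)
  then show ?thesis by (simp add: map_dist_def)
qed

text \<open>Brings tangency into the shape of the pointwise bounds for \<open>map_dist\<close>, so
  that distance 0 becomes the case \<open>K = 0\<close> of both.\<close>

lemma tangent_at_iff_eventually:
  "tangent_at a f g \<longleftrightarrow> (\<forall>e>0. \<forall>\<^sub>F x in nhds a. dist (f x) (g x) \<le> e * dist x a)"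
  by (simp add: tangent_at_def eventually_nhds_metric_le)

lemma map_dist_eq_0_iff:
  assumes fg: "f \<in> LL_maps a a'" "g \<in> LL_maps a a'"
  shows "map_dist a f g = 0 \<longleftrightarrow> tangent_at a f g"
proof
  show "tangent_at a f g" if "map_dist a f g = 0"
    using map_dist_eventually_le[OF fg] that by (simp add: tangent_at_iff_eventually)
  show "map_dist a f g = 0" if "tangent_at a f g"
    using map_dist_leI[OF fg, of 0] map_dist_nonneg[OF fg] that
    by (simp add: tangent_at_iff_eventually)
qed

lemma map_dist_triangle:
  assumes f: "f \<in> LL_maps a a'" and g: "g \<in> LL_maps a a'" and h: "h \<in> LL_maps a a'"
  shows "map_dist a f h \<le> map_dist a f g + map_dist a g h"
proof (rule map_dist_leI[OF f h])
  show "0 \<le> map_dist a f g + map_dist a g h"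
    using f g h by (simp add: map_dist_nonneg)
  fix e :: real assume "e > 0"
  then have e: "e / 2 > 0" by simp
  show "\<forall>\<^sub>F x in nhds a. dist (f x) (h x) \<le> (map_dist a f g + map_dist a g h + e) * dist x a"
    using map_dist_eventually_le[OF f g e] map_dist_eventually_le[OF g h e]
  proof eventually_elim
    case (elim x)
    then show ?case
      using dist_triangle[of "f x" "h x" "g x"] by (simp add: algebra_simps)
  qed
qed

section \<open>Effect of composition on the distance of maps\<close>

lemma LL_maps_tendsto:
  assumes "f \<in> LL_maps a a'"
  shows "filterlim f (nhds a') (nhds a)"
proof -
  obtain k r where f: "k > 0" "r > 0" "k-lipschitz_on (cball a r) f" "f a = a'"
    using assms by (rule LL_mapsE)
  have "isCont f a"
    using lipschitz_on_continuous_on[OF f(3)] f(2)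
    by (intro continuous_on_interior[of "cball a r"]) (auto simp: mem_interior_cball)
  then show ?thesis using f(4) by (auto simp: isCont_def tendsto_nhds_iff)
qed

lemma lip_nearE:
  assumes "lip_near k a f"
  obtains U where "\<forall>\<^sub>F x in nhds a. x \<in> U" "a \<in> U" "k-lipschitz_on U f"
proof -
  obtain U where U: "a \<in> interior U" "k-lipschitz_on U f"
    using assms by (auto simp: lip_near_def)
  moreover have "\<forall>\<^sub>F x in nhds a. x \<in> U"
    using U(1) interior_subset by (auto simp: eventually_nhds intro!: exI[of _ "interior U"])
  ultimately show thesis using that interior_subset by blast
qed

text \<open>Near \<open>a\<close> both inner maps take values where \<open>g\<close> is
  \<open>k\<close>-Lipschitz, so \<open>g\<close> stretches the distance of their values by at most
  \<open>k\<close>.\<close>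

lemma map_dist_comp_left:
  assumes f: "f1 \<in> LL_maps a b" "f2 \<in> LL_maps a b" and g: "g \<in> LL_maps b c" "lip_near k b g"
    and k: "k > 0"
  shows "map_dist a (g \<circ> f1) (g \<circ> f2) \<le> k * map_dist a f1 f2"
proof (rule map_dist_leI[OF LL_maps_comp[OF f(1) g(1)] LL_maps_comp[OF f(2) g(1)]])
  show "0 \<le> k * map_dist a f1 f2" using f k by (simp add: map_dist_nonneg)
  obtain U where U: "\<forall>\<^sub>F y in nhds b. y \<in> U" "k-lipschitz_on U g"
    using g(2) by (rule lip_nearE)
  \<comment> \<open>Continuity at \<open>a\<close> pulls the neighbourhood \<open>U\<close> of
    \<open>b\<close> back along both maps.\<close>
  have fU: "\<forall>\<^sub>F x in nhds a. f1 x \<in> U" "\<forall>\<^sub>F x in nhds a. f2 x \<in> U"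
    by (rule eventually_compose_filterlim[OF U(1) LL_maps_tendsto]; fact)+
  fix e :: real assume "e > 0"
  \<comment> \<open>The error is divided by \<open>k\<close> in advance because the Lipschitz bound
    multiplies it by \<open>k\<close>.\<close>
  then have e: "e / k > 0" using k by simp
  show "\<forall>\<^sub>F x in nhds a. dist ((g \<circ> f1) x) ((g \<circ> f2) x) \<le> (k * map_dist a f1 f2 + e) * dist x a"
    using map_dist_eventually_le[OF f e] fU
  proof eventually_elim
    case (elim x)
    have "dist (g (f1 x)) (g (f2 x)) \<le> k * dist (f1 x) (f2 x)"
      using elim by (intro lipschitz_onD[OF U(2)])
    also have "\<dots> \<le> k * ((map_dist a f1 f2 + e / k) * dist x a)"
      using elim k by (intro mult_left_mono) auto
    also have "\<dots> = (k * map_dist a f1 f2 + e) * dist x a"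
      using k by (simp add: field_simps)
    finally show ?case by simp
  qed
qed

text \<open>The bound for \<open>g1\<close> and \<open>g2\<close> is evaluated at
  \<open>f x\<close>; there it is relative to \<open>dist (f x) b\<close>, which is at most
  \<open>k * dist x a\<close> because \<open>f a = b\<close>.\<close>

lemma map_dist_comp_right:
  assumes f: "f \<in> LL_maps a b" "lip_near k a f" and g: "g1 \<in> LL_maps b c" "g2 \<in> LL_maps b c"
    and k: "k > 0"
  shows "map_dist a (g1 \<circ> f) (g2 \<circ> f) \<le> k * map_dist b g1 g2"
proof (rule map_dist_leI[OF LL_maps_comp[OF f(1) g(1)] LL_maps_comp[OF f(1) g(2)]])
  show "0 \<le> k * map_dist b g1 g2" using g k by (simp add: map_dist_nonneg)
  obtain U where U: "\<forall>\<^sub>F x in nhds a. x \<in> U" "a \<in> U" "k-lipschitz_on U f"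
    using f(2) by (rule lip_nearE)
  have fa: "f a = b" using f(1) by (simp add: LL_maps_def)
  fix e :: real assume "e > 0"
  then have e: "e / k > 0" using k by simp
  have "\<forall>\<^sub>F x in nhds a. dist (g1 (f x)) (g2 (f x)) \<le> (map_dist b g1 g2 + e / k) * dist (f x) b"
    using map_dist_eventually_le[OF g e] LL_maps_tendsto[OF f(1)]
    by (rule eventually_compose_filterlim)
  then show "\<forall>\<^sub>F x in nhds a. dist ((g1 \<circ> f) x) ((g2 \<circ> f) x) \<le> (k * map_dist b g1 g2 + e) * dist x a"
    using U(1)
  proof eventually_elim
    case (elim x)
    have "dist (f x) b \<le> k * dist x a"
      using lipschitz_onD[OF U(3) elim(2) U(2)] fa by simp
    then have "(map_dist b g1 g2 + e / k) * dist (f x) b \<le> (map_dist b g1 g2 + e / k) * (k * dist x a)"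
      using map_dist_nonneg[OF g] e by (intro mult_left_mono) auto
    also have "\<dots> = (k * map_dist b g1 g2 + e) * dist x a"
      using k by (simp add: field_simps)
    finally show ?case using elim by simp
  qed
qed

section \<open>The metric category of jets\<close>

lemma JetE:
  assumes "\<phi> \<in> Jet a b"
  obtains f where "f \<in> LL_maps a b" "\<phi> = jet_of a f"
  using assms by (auto simp: Jet_eq)

lemma jet_of_in_Jet: "f \<in> LL_maps a b \<Longrightarrow> jet_of a f \<in> Jet a b"
  by (auto simp: Jet_eq)

text \<open>Every member of a jet may serve as its representative, in particular one selected for
  its Lipschitz constant.\<close>

lemma Jet_memD:
  assumes "\<phi> \<in> Jet a b" "f \<in> \<phi>"
  shows "f \<in> LL_maps a b" "\<phi> = jet_of a f"
proof -
  obtain g where g: "g \<in> LL_maps a b" "\<phi> = jet_of a g" using assms(1) by (rule JetE)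
  then have "f \<in> LL_maps a b \<and> tangent_at a g f"
    using assms(2) mem_jet_of by blast
  then show "f \<in> LL_maps a b" "\<phi> = jet_of a f"
    using g jet_of_eq_iff by blast+
qed

lemma id_in_LL_maps: "id \<in> LL_maps a a"
  by (rule LL_mapsI[of 1 1]) (auto simp: lipschitz_on_def)

lemma jet_comp_in_Jet:
  assumes "\<phi> \<in> Jet a b" "\<psi> \<in> Jet b c"
  shows "jet_comp a \<psi> \<phi> \<in> Jet a c"
  using assms by (auto elim!: JetE simp: jet_comp_jet_of LL_maps_comp jet_of_in_Jet)

lemma jet_comp_assoc:
  assumes "\<phi> \<in> Jet a b" "\<psi> \<in> Jet b c" "\<xi> \<in> Jet c d"
  shows "jet_comp a (jet_comp b \<xi> \<psi>) \<phi> = jet_comp a \<xi> (jet_comp a \<psi> \<phi>)"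
proof -
  obtain f g h where "f \<in> LL_maps a b" "\<phi> = jet_of a f" "g \<in> LL_maps b c" "\<psi> = jet_of b g"
    "h \<in> LL_maps c d" "\<xi> = jet_of c h"
    using assms by (auto elim!: JetE)
  then show ?thesis
    using LL_maps_comp[of f a b g c] LL_maps_comp[of g b c h d]
    by (simp add: jet_comp_jet_of comp_assoc)
qed

lemma jet_comp_id_left:
  assumes "\<phi> \<in> Jet a b"
  shows "jet_comp a (jet_of b id) \<phi> = \<phi>"
  using assms by (auto elim!: JetE simp: jet_comp_jet_of[OF _ id_in_LL_maps])

lemma jet_comp_id_right:
  assumes "\<phi> \<in> Jet a b"
  shows "jet_comp a \<phi> (jet_of a id) = \<phi>"
  using assms by (auto elim!: JetE simp: jet_comp_jet_of[OF id_in_LL_maps])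

section \<open>Metric axioms for parallel jets\<close>

lemma jet_dist_nonneg:
  assumes "\<phi> \<in> Jet a b" "\<psi> \<in> Jet a b"
  shows "0 \<le> jet_dist a \<phi> \<psi>"
  using assms by (auto elim!: JetE simp: jet_dist_jet_of map_dist_nonneg)

lemma jet_dist_commute:
  assumes "\<phi> \<in> Jet a b" "\<psi> \<in> Jet a b"
  shows "jet_dist a \<phi> \<psi> = jet_dist a \<psi> \<phi>"
  using assms by (elim JetE) (simp add: jet_dist_jet_of map_dist_commute)

lemma jet_dist_eq_0_iff:
  assumes "\<phi> \<in> Jet a b" "\<psi> \<in> Jet a b"
  shows "jet_dist a \<phi> \<psi> = 0 \<longleftrightarrow> \<phi> = \<psi>"
  using assms by (elim JetE) (simp add: jet_dist_jet_of map_dist_eq_0_iff jet_of_eq_iff)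

lemma jet_dist_triangle:
  assumes "\<phi> \<in> Jet a b" "\<psi> \<in> Jet a b" "\<xi> \<in> Jet a b"
  shows "jet_dist a \<phi> \<xi> \<le> jet_dist a \<phi> \<psi> + jet_dist a \<psi> \<xi>"
  using assms by (auto elim!: JetE simp: jet_dist_jet_of map_dist_triangle)

section \<open>Composition and the Lipschitz ratio\<close>

text \<open>The infimum in \<open>lip_ratio\<close> need not be attained, so a representative is
  only obtained for each bound \<open>K\<close> strictly above it. The set of constants is non-empty
  because every representative is locally Lipschitz.\<close>

lemma lip_ratio_less_obtain:
  assumes "\<phi> \<in> Jet a b" "lip_ratio a \<phi> < K"
  obtains f k where "f \<in> LL_maps a b" "\<phi> = jet_of a f" "0 < k" "k < K" "lip_near k a f"
proof -
  obtain f where f: "f \<in> LL_maps a b" "\<phi> = jet_of a f" using assms(1) by (rule JetE)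
  then have "f \<in> \<phi>" by (simp add: mem_jet_of tangent_at_refl)
  then have "{k. k > 0 \<and> (\<exists>f\<in>\<phi>. lip_near k a f)} \<noteq> {}"
    using f(1) by (auto simp: LL_maps_def LL_at_def)
  from cInf_lessD[OF this assms(2)[unfolded lip_ratio_def]]
  obtain k g where k: "0 < k" "k < K" and g: "g \<in> \<phi>" "lip_near k a g" by blast
  show thesis by (rule that[OF Jet_memD[OF assms(1) g(1)] k g(2)])
qed

text \<open>Passes from the constants \<open>k < K\<close>, with \<open>K\<close> arbitrarily close
  to \<open>\<rho>\<close>, to \<open>\<rho>\<close> itself; this makes up for an infimum that is
  not attained.\<close>

lemma le_mult_of_greater:
  fixes A d \<rho> :: real
  assumes "0 \<le> d" and le: "\<And>K. \<rho> < K \<Longrightarrow> \<exists>k<K. A \<le> k * d"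
  shows "A \<le> \<rho> * d"
proof (rule ccontr)
  assume "\<not> A \<le> \<rho> * d"
  then have A: "\<rho> * d < A" by simp
  show False
  proof (cases "d = 0")
    case True
    then show False using A le[of "\<rho> + 1"] by auto
  next
    case False
    \<comment> \<open>The quotient \<open>A / d\<close> is itself taken as \<open>K\<close>: a
      \<open>k\<close> below it cannot satisfy \<open>A \<le> k * d\<close>.\<close>
    then have "\<rho> < A / d" using A assms(1) by (simp add: field_simps)
    then obtain k where "k < A / d" "A \<le> k * d" using le by blast
    then show False using False assms(1) by (simp add: field_simps)
  qed
qed

text \<open>A representative of \<open>\<xi>\<close> with Lipschitz constant \<open>k < K\<close>
  gives the estimate with factor \<open>k\<close>; then \<open>K\<close> is brought down to the
  Lipschitz ratio.\<close>

lemma jet_dist_comp_left: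
  assumes \<phi>: "\<phi> \<in> Jet a b" and \<psi>: "\<psi> \<in> Jet a b" and \<xi>: "\<xi> \<in> Jet b c"
  shows "jet_dist a (jet_comp a \<xi> \<phi>) (jet_comp a \<xi> \<psi>) \<le> lip_ratio b \<xi> * jet_dist a \<phi> \<psi>"
proof (rule le_mult_of_greater)
  show "0 \<le> jet_dist a \<phi> \<psi>" using \<phi> \<psi> by (rule jet_dist_nonneg)
  fix K assume "lip_ratio b \<xi> < K"
  then obtain g k where g: "g \<in> LL_maps b c" "\<xi> = jet_of b g" "0 < k" "k < K" "lip_near k b g"
    by (rule lip_ratio_less_obtain[OF \<xi>])
  obtain f1 f2 where f: "f1 \<in> LL_maps a b" "\<phi> = jet_of a f1" "f2 \<in> LL_maps a b" "\<psi> = jet_of a f2"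
    using \<phi> \<psi> by (auto elim!: JetE)
  show "\<exists>k<K. jet_dist a (jet_comp a \<xi> \<phi>) (jet_comp a \<xi> \<psi>) \<le> k * jet_dist a \<phi> \<psi>"
    unfolding f(2,4) g(2) jet_comp_jet_of[OF f(1) g(1)] jet_comp_jet_of[OF f(3) g(1)]
      jet_dist_jet_of[OF f(1,3)]
      jet_dist_jet_of[OF LL_maps_comp[OF f(1) g(1)] LL_maps_comp[OF f(3) g(1)]]
    using map_dist_comp_left[OF f(1,3) g(1,5,3)] g(4) by blast
qed

lemma jet_dist_comp_right:
  assumes \<phi>: "\<phi> \<in> Jet b c" and \<psi>: "\<psi> \<in> Jet b c" and \<xi>: "\<xi> \<in> Jet a b"
  shows "jet_dist a (jet_comp a \<phi> \<xi>) (jet_comp a \<psi> \<xi>) \<le> lip_ratio a \<xi> * jet_dist b \<phi> \<psi>"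
proof (rule le_mult_of_greater)
  show "0 \<le> jet_dist b \<phi> \<psi>" using \<phi> \<psi> by (rule jet_dist_nonneg)
  fix K assume "lip_ratio a \<xi> < K"
  then obtain f k where f: "f \<in> LL_maps a b" "\<xi> = jet_of a f" "0 < k" "k < K" "lip_near k a f"
    by (rule lip_ratio_less_obtain[OF \<xi>])
  obtain g1 g2 where g: "g1 \<in> LL_maps b c" "\<phi> = jet_of b g1" "g2 \<in> LL_maps b c" "\<psi> = jet_of b g2"
    using \<phi> \<psi> by (auto elim!: JetE)
  show "\<exists>k<K. jet_dist a (jet_comp a \<phi> \<xi>) (jet_comp a \<psi> \<xi>) \<le> k * jet_dist b \<phi> \<psi>"
    unfolding f(2) g(2,4) jet_comp_jet_of[OF f(1) g(1)] jet_comp_jet_of[OF f(1) g(3)]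
      jet_dist_jet_of[OF g(1,3)]
      jet_dist_jet_of[OF LL_maps_comp[OF f(1) g(1)] LL_maps_comp[OF f(1) g(3)]]
    using map_dist_comp_right[OF f(1,5) g(1,3) f(3)] f(4) by blast
qed

text \<open>The factor \<open>lip_ratio a (\<gamma> a b)\<close> is at most 1, and the distance it
  multiplies is nonnegative.\<close>

lemma (in transmetric_space) jet_dist_transport_left:
  assumes "\<phi> \<in> Jet p a" "\<psi> \<in> Jet p a"
  shows "jet_dist p (jet_comp p (\<gamma> a b) \<phi>) (jet_comp p (\<gamma> a b) \<psi>) \<le> jet_dist p \<phi> \<psi>"
  using jet_dist_comp_left[OF assms trans_jet[of a b]]
    mult_right_mono[OF trans_ratio[of a b] jet_dist_nonneg[OF assms]] by linarith

lemma (in transmetric_space) jet_dist_transport_right: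
  assumes "\<phi> \<in> Jet b p" "\<psi> \<in> Jet b p"
  shows "jet_dist a (jet_comp a \<phi> (\<gamma> a b)) (jet_comp a \<psi> (\<gamma> a b)) \<le> jet_dist b \<phi> \<psi>"
  using jet_dist_comp_right[OF assms trans_jet[of a b]]
    mult_right_mono[OF trans_ratio[of a b] jet_dist_nonneg[OF assms]] by linarith

section \<open>Free jets\<close>

locale transmetric_pair = S: transmetric_space \<gamma> + T: transmetric_space \<gamma>'
  for \<gamma> :: "'a::metric_space \<Rightarrow> 'a \<Rightarrow> ('a, 'a) jet"
    and \<gamma>' :: "'b::metric_space \<Rightarrow> 'b \<Rightarrow> ('b, 'b) jet"
begin

text \<open>The two jets compared by \<open>J_dist\<close> are parallel, so the metric axioms for
  jets apply to them.\<close>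

lemma transported_in_Jet:
  assumes "\<phi> \<in> Jet a a'" "\<psi> \<in> Jet b b'"
  shows "jet_comp a (\<gamma>' a' b') \<phi> \<in> Jet a b'" "jet_comp a \<psi> (\<gamma> a b) \<in> Jet a b'"
  by (rule jet_comp_in_Jet[OF assms(1) T.trans_jet], rule jet_comp_in_Jet[OF S.trans_jet assms(2)])

section \<open>The pseudometric on jets with varying base points\<close>

lemma J_dist_nonneg:
  assumes "p \<in> J" "q \<in> J"
  shows "0 \<le> J_dist \<gamma> \<gamma>' p q"
proof -
  obtain \<phi> a a' where p: "p = (\<phi>, a, a')" by (rule prod_cases3)
  obtain \<psi> b b' where q: "q = (\<psi>, b, b')" by (rule prod_cases3)
  note pq = p q
  then have "\<phi> \<in> Jet a a'" "\<psi> \<in> Jet b b'" using assms by (auto simp: J_def)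
  then show ?thesis
    using jet_dist_nonneg[OF transported_in_Jet] pq by simp
qed

text \<open>Parallel jets at distance 0 coincide. Hence everything about the relation can be read
  off from the pseudometric axioms.\<close>

lemma J_equiv_iff:
  "(p, q) \<in> J_equiv \<gamma> \<gamma>' \<longleftrightarrow> p \<in> J \<and> q \<in> J \<and> J_dist \<gamma> \<gamma>' p q = 0"
proof -
  obtain \<phi> a a' where p: "p = (\<phi>, a, a')" by (rule prod_cases3)
  obtain \<psi> b b' where q: "q = (\<psi>, b, b')" by (rule prod_cases3)
  note pq = p q
  show ?thesis
  proof (cases "p \<in> J \<and> q \<in> J")
    case True
    then have "\<phi> \<in> Jet a a'" "\<psi> \<in> Jet b b'" using pq by (auto simp: J_def)
    then show ?thesis
      using jet_dist_eq_0_iff[OF transported_in_Jet] pq True by (simp add: J_equiv_def)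
  qed (use pq in \<open>auto simp: J_equiv_def\<close>)
qed

lemma J_dist_self:
  assumes "p \<in> J"
  shows "J_dist \<gamma> \<gamma>' p p = 0"
proof -
  obtain \<phi> a a' where p: "p = (\<phi>, a, a')" by (rule prod_cases3)
  then have "\<phi> \<in> Jet a a'" using assms by (simp add: J_def)
  then show ?thesis
    using p jet_dist_eq_0_iff[of \<phi> a a' \<phi>]
    by (simp add: S.trans_id T.trans_id jet_comp_id_left jet_comp_id_right)
qed

text \<open>The comparison for \<open>(p, q)\<close> is made between jets from \<open>a\<close> to
  \<open>b'\<close>, the one for \<open>(q, p)\<close> between jets from \<open>b\<close> to
  \<open>a'\<close>. Transporting the former along \<open>\<gamma>' b' a'\<close> and
  \<open>\<gamma> b a\<close> yields the latter, and both transports are contractive. Exchanging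
  \<open>p\<close> and \<open>q\<close> gives equality.\<close>

lemma J_dist_commute_le:
  assumes "p \<in> J" "q \<in> J"
  shows "J_dist \<gamma> \<gamma>' q p \<le> J_dist \<gamma> \<gamma>' p q"
proof -
  obtain \<phi> a a' where p: "p = (\<phi>, a, a')" by (rule prod_cases3)
  obtain \<psi> b b' where q: "q = (\<psi>, b, b')" by (rule prod_cases3)
  note pq = p q
  then have \<phi>: "\<phi> \<in> Jet a a'" and \<psi>: "\<psi> \<in> Jet b b'" using assms by (auto simp: J_def)
  let ?\<phi> = "jet_comp a (\<gamma>' a' b') \<phi>" and ?\<psi> = "jet_comp a \<psi> (\<gamma> a b)"
  have m: "?\<phi> \<in> Jet a b'" "?\<psi> \<in> Jet a b'" using transported_in_Jet[OF \<phi> \<psi>] .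
  \<comment> \<open>The round trip from \<open>b\<close> to \<open>a\<close> and back is the
    identity jet, so \<open>\<psi>\<close> is recovered from its transport.\<close>
  have "jet_comp b ?\<psi> (\<gamma> b a) = \<psi>"
    using jet_comp_assoc[OF S.trans_jet S.trans_jet \<psi>] jet_comp_id_right[OF \<psi>]
    by (simp add: S.trans_comp S.trans_id)
  then have 1: "jet_comp b (\<gamma>' b' a') \<psi> = jet_comp b (jet_comp a (\<gamma>' b' a') ?\<psi>) (\<gamma> b a)"
    using jet_comp_assoc[OF S.trans_jet m(2) T.trans_jet] by simp
  have 2: "\<phi> = jet_comp a (\<gamma>' b' a') ?\<phi>"
    using jet_comp_assoc[OF \<phi> T.trans_jet T.trans_jet] jet_comp_id_left[OF \<phi>]
    by (simp add: T.trans_comp T.trans_id)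
  have "J_dist \<gamma> \<gamma>' q p = jet_dist b (jet_comp b (jet_comp a (\<gamma>' b' a') ?\<psi>) (\<gamma> b a))
      (jet_comp b (jet_comp a (\<gamma>' b' a') ?\<phi>) (\<gamma> b a))"
    using pq 1 2 by simp
  also have "\<dots> \<le> jet_dist a (jet_comp a (\<gamma>' b' a') ?\<psi>) (jet_comp a (\<gamma>' b' a') ?\<phi>)"
    using jet_comp_in_Jet[OF m(2) T.trans_jet] jet_comp_in_Jet[OF m(1) T.trans_jet]
    by (rule S.jet_dist_transport_right)
  also have "\<dots> \<le> jet_dist a ?\<psi> ?\<phi>"
    using m(2,1) by (rule T.jet_dist_transport_left)
  also have "\<dots> = J_dist \<gamma> \<gamma>' p q"
    using pq jet_dist_commute[OF m] by simp
  finally show ?thesis .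
qed

lemma J_dist_commute:
  assumes "p \<in> J" "q \<in> J"
  shows "J_dist \<gamma> \<gamma>' p q = J_dist \<gamma> \<gamma>' q p"
  using assms by (intro antisym J_dist_commute_le)

text \<open>All three comparisons are moved to jets from \<open>a\<close> to \<open>c'\<close>, with
  \<open>\<psi>\<close> transported on both sides as the intermediate jet. The two resulting
  distances come from those of \<open>(p, q)\<close> and \<open>(q, r)\<close> by one contractive
  transport each.\<close>

lemma J_dist_triangle:
  assumes "p \<in> J" "q \<in> J" "r \<in> J"
  shows "J_dist \<gamma> \<gamma>' p r \<le> J_dist \<gamma> \<gamma>' p q + J_dist \<gamma> \<gamma>' q r"
proof -
  obtain \<phi> a a' where p: "p = (\<phi>, a, a')" by (rule prod_cases3)
  obtain \<psi> b b' where q: "q = (\<psi>, b, b')" by (rule prod_cases3)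
  obtain \<theta> c c' where r: "r = (\<theta>, c, c')" by (rule prod_cases3)
  note pqr = p q r
  then have \<phi>: "\<phi> \<in> Jet a a'" and \<psi>: "\<psi> \<in> Jet b b'" and \<theta>: "\<theta> \<in> Jet c c'"
    using assms by (auto simp: J_def)
  note m = transported_in_Jet[OF \<phi> \<psi>] and m' = transported_in_Jet[OF \<psi> \<theta>]
    and m'' = transported_in_Jet[OF \<phi> \<theta>]
  let ?\<psi> = "jet_comp a (\<gamma>' b' c') (jet_comp a \<psi> (\<gamma> a b))"
  \<comment> \<open>The target transport is factored through \<open>b'\<close> and the source
    transport through \<open>b\<close>; associativity then writes the intermediate jet in both
    matching forms.\<close>
  have 1: "jet_comp a (\<gamma>' a' c') \<phi> = jet_comp a (\<gamma>' b' c') (jet_comp a (\<gamma>' a' b') \<phi>)"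
    using jet_comp_assoc[OF \<phi> T.trans_jet T.trans_jet] by (simp add: T.trans_comp)
  have 2: "jet_comp a \<theta> (\<gamma> a c) = jet_comp a (jet_comp b \<theta> (\<gamma> b c)) (\<gamma> a b)"
    using jet_comp_assoc[OF S.trans_jet S.trans_jet \<theta>] by (simp add: S.trans_comp)
  have 3: "?\<psi> = jet_comp a (jet_comp b (\<gamma>' b' c') \<psi>) (\<gamma> a b)"
    using jet_comp_assoc[OF S.trans_jet \<psi> T.trans_jet] by simp
  have "?\<psi> \<in> Jet a c'" using m(2) T.trans_jet by (rule jet_comp_in_Jet)
  then have "J_dist \<gamma> \<gamma>' p r \<le>
      jet_dist a (jet_comp a (\<gamma>' a' c') \<phi>) ?\<psi> + jet_dist a ?\<psi> (jet_comp a \<theta> (\<gamma> a c))"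
    using jet_dist_triangle[OF m''(1) _ m''(2)] pqr by simp
  moreover have "jet_dist a (jet_comp a (\<gamma>' a' c') \<phi>) ?\<psi> \<le> J_dist \<gamma> \<gamma>' p q"
    unfolding 1 using T.jet_dist_transport_left[OF m] pqr by simp
  moreover have "jet_dist a ?\<psi> (jet_comp a \<theta> (\<gamma> a c)) \<le> J_dist \<gamma> \<gamma>' q r"
    unfolding 2 3 using S.jet_dist_transport_right[OF m'] pqr by simp
  ultimately show ?thesis by linarith
qed

section \<open>Passage to the quotient\<close>

lemma equiv_J_equiv: "equiv J (J_equiv \<gamma> \<gamma>')"
proof (rule equivI)
  show "J_equiv \<gamma> \<gamma>' \<subseteq> J \<times> J" by (auto simp: J_equiv_def)
  show "refl_on J (J_equiv \<gamma> \<gamma>')" by (auto simp: refl_on_def J_equiv_iff J_dist_self)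
  show "sym (J_equiv \<gamma> \<gamma>')" by (auto simp: sym_def J_equiv_iff J_dist_commute)
  show "trans (J_equiv \<gamma> \<gamma>')"
  proof (rule transI)
    fix p q r assume "(p, q) \<in> J_equiv \<gamma> \<gamma>'" "(q, r) \<in> J_equiv \<gamma> \<gamma>'"
    then show "(p, r) \<in> J_equiv \<gamma> \<gamma>'"
      using J_dist_triangle[of p q r] J_dist_nonneg[of p r] by (simp add: J_equiv_iff)
  qed
qed

text \<open>Moving to an equivalent representative costs 0 in the triangle inequality, so neither
  distance exceeds the other.\<close>

lemma J_dist_respects2: "J_dist \<gamma> \<gamma>' respects2 J_equiv \<gamma> \<gamma>'"
proof (rule congruent2I')
  \<comment> \<open>The second pair runs from \<open>q2\<close> to \<open>q1\<close>, so that the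
    hypotheses are the two end steps of the path \<open>p1\<close>, \<open>p2\<close>,
    \<open>q2\<close>, \<open>q1\<close>.\<close>
  have le: "J_dist \<gamma> \<gamma>' p1 q1 \<le> J_dist \<gamma> \<gamma>' p2 q2"
    if "(p1, p2) \<in> J_equiv \<gamma> \<gamma>'" "(q2, q1) \<in> J_equiv \<gamma> \<gamma>'" for p1 p2 q1 q2
    using that J_dist_triangle[of p1 p2 q1] J_dist_triangle[of p2 q2 q1]
    by (simp add: J_equiv_iff)
  fix p1 p2 q1 q2 assume "(p1, p2) \<in> J_equiv \<gamma> \<gamma>'" "(q1, q2) \<in> J_equiv \<gamma> \<gamma>'"
  moreover from this have "(p2, p1) \<in> J_equiv \<gamma> \<gamma>'" "(q2, q1) \<in> J_equiv \<gamma> \<gamma>'"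
    by (simp_all add: J_equiv_iff J_dist_commute)
  ultimately show "J_dist \<gamma> \<gamma>' p1 q1 = J_dist \<gamma> \<gamma>' p2 q2"
    by (intro antisym le)
qed

text \<open>
  \<^const>\<open>Metric_space\<close> demands nonnegativity and symmetry on the whole type, hence the junk value 0.
\<close>

definition Jet_free_dist ::
  "(('a, 'b) jet \<times> 'a \<times> 'b) set \<Rightarrow> (('a, 'b) jet \<times> 'a \<times> 'b) set \<Rightarrow> real" where
  "Jet_free_dist P Q =
     (if P \<in> Jet_free \<gamma> \<gamma>' \<and> Q \<in> Jet_free \<gamma> \<gamma>'
      then J_dist \<gamma> \<gamma>' (SOME p. p \<in> P) (SOME q. q \<in> Q) else 0)"

text \<open>The chosen elements are equivalent to the given \<open>p\<close> and \<open>q\<close>,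
  and \<open>J_dist\<close> does not see the difference.\<close>

lemma Jet_free_dist_class:
  assumes "p \<in> J" "q \<in> J"
  shows "Jet_free_dist (J_equiv \<gamma> \<gamma>' `` {p}) (J_equiv \<gamma> \<gamma>' `` {q}) = J_dist \<gamma> \<gamma>' p q"
proof -
  \<comment> \<open>Each class contains its generator by reflexivity, so the choice does pick a
    member.\<close>
  have "(r, SOME s. s \<in> J_equiv \<gamma> \<gamma>' `` {r}) \<in> J_equiv \<gamma> \<gamma>'" if "r \<in> J" for r
    using someI_ex[of "\<lambda>s. s \<in> J_equiv \<gamma> \<gamma>' `` {r}"] equiv_class_self[OF equiv_J_equiv that]
    by blast
  then have "J_dist \<gamma> \<gamma>' p q =
      J_dist \<gamma> \<gamma>' (SOME s. s \<in> J_equiv \<gamma> \<gamma>' `` {p}) (SOME s. s \<in> J_equiv \<gamma> \<gamma>' `` {q})"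
    using assms by (intro congruent2D[OF J_dist_respects2])
  then show ?thesis
    using assms by (simp add: Jet_free_dist_def Jet_free_def quotientI)
qed

lemma Jet_freeE:
  assumes "P \<in> Jet_free \<gamma> \<gamma>'"
  obtains p where "p \<in> J" "P = J_equiv \<gamma> \<gamma>' `` {p}"
  using assms unfolding Jet_free_def by (rule quotientE)

lemma Metric_space_Jet_free: "Metric_space (Jet_free \<gamma> \<gamma>') Jet_free_dist"
proof
  fix P Q
  have "0 \<le> Jet_free_dist P Q \<and> Jet_free_dist P Q = Jet_free_dist Q P"
  proof (cases "P \<in> Jet_free \<gamma> \<gamma>' \<and> Q \<in> Jet_free \<gamma> \<gamma>'")
    case True
    then obtain p q where "p \<in> J" "P = J_equiv \<gamma> \<gamma>' `` {p}" "q \<in> J" "Q = J_equiv \<gamma> \<gamma>' `` {q}"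
      by (meson Jet_freeE)
    then show ?thesis by (simp add: Jet_free_dist_class J_dist_nonneg J_dist_commute)
  qed (auto simp: Jet_free_dist_def)
  then show "0 \<le> Jet_free_dist P Q" "Jet_free_dist P Q = Jet_free_dist Q P" by auto
next
  fix P Q assume "P \<in> Jet_free \<gamma> \<gamma>'" "Q \<in> Jet_free \<gamma> \<gamma>'"
  then obtain p q where "p \<in> J" "P = J_equiv \<gamma> \<gamma>' `` {p}" "q \<in> J" "Q = J_equiv \<gamma> \<gamma>' `` {q}"
    by (meson Jet_freeE)
  \<comment> \<open>Both sides say that the generators are equivalent: distance 0 by
    \<open>J_equiv_iff\<close>, equality of classes because the relation is an equivalence.\<close>
  then show "Jet_free_dist P Q = 0 \<longleftrightarrow> P = Q"
    by (simp add: Jet_free_dist_class eq_equiv_class_iff[OF equiv_J_equiv] J_equiv_iff)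
next
  fix P Q R assume "P \<in> Jet_free \<gamma> \<gamma>'" "Q \<in> Jet_free \<gamma> \<gamma>'" "R \<in> Jet_free \<gamma> \<gamma>'"
  then obtain p q r where "p \<in> J" "P = J_equiv \<gamma> \<gamma>' `` {p}" "q \<in> J" "Q = J_equiv \<gamma> \<gamma>' `` {q}"
    "r \<in> J" "R = J_equiv \<gamma> \<gamma>' `` {r}"
    by (meson Jet_freeE)
  then show "Jet_free_dist P R \<le> Jet_free_dist P Q + Jet_free_dist Q R"
    by (simp add: Jet_free_dist_class J_dist_triangle)
qed

end

theorem proposition1p4p13:
  fixes \<gamma> :: "'a::metric_space \<Rightarrow> 'a \<Rightarrow> ('a, 'a) jet"
    and \<gamma>' :: "'b::metric_space \<Rightarrow> 'b \<Rightarrow> ('b, 'b) jet"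
  assumes "transmetric_space \<gamma>" and "transmetric_space \<gamma>'"
  shows "(\<forall>p\<in>J. \<forall>q\<in>J. 0 \<le> J_dist \<gamma> \<gamma>' p q) \<and>
         J_dist \<gamma> \<gamma>' respects2 J_equiv \<gamma> \<gamma>' \<and>
         (\<exists>D. Metric_space (Jet_free \<gamma> \<gamma>') D \<and>
              (\<forall>p\<in>J. \<forall>q\<in>J.
                 D (J_equiv \<gamma> \<gamma>' `` {p}) (J_equiv \<gamma> \<gamma>' `` {q}) = J_dist \<gamma> \<gamma>' p q))"
proof -
  interpret transmetric_pair \<gamma> \<gamma>'
    using assms by (rule transmetric_pair.intro)
  show ?thesis
    using J_dist_nonneg J_dist_respects2 Metric_space_Jet_free Jet_free_dist_class by blast
qed

end
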